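(* Consider a run of DFPN with Grundy numbers (as defined in the context) on the extended NAND tree of a position of an impartial game under the normal play convention. At every moment of the search, for every node $v$ of the currently explored path $\mathcal{P}$, the most proving node (MPN) is in the subtree of $v$ if and only if all three of the following inequalities hold: $$pn(v) < pt(v),\qquad dn(v) < dt(v),\qquad \min\{pn(v)+ps(v),\ dn(v)+ds(v)\} < mt(v),$$ where $\infty<\infty$ is interpreted as false.
   Context: **Games.** $G$ is an impartial game under the normal play convention: two players, perfect information, finite play, both players have the same moves from each position, and a player unable to move loses. The combination $P_1+\dots+P_k$ of positions is the position in which each move is made in exactly one component; a player with no move in any component loses. A position is decomposable if it is a combination of at least two non-empty positions, in which case write $P=P_1+\dots+P_k$ with $k\ge 2$ and all $P_i$ non-empty and atomic; otherwise it is atomic. $\ast n$ denotes the Nim position with one heap of $n$ objects. The Grundy number $gn(P)$ is $0$ for terminal $P$, and otherwise the least non-negative integer that is not the Grundy number of a child of $P$. Equivalently, $gn(P)=n$ iff the player to move loses in $P+\ast n$. $\oplus$ is bitwise exclusive or. **Extended NAND tree (Grundy nodes already replaced).** Nodes correspond to couples $P+\ast n$ with $P$ a position of $G$ and $n\in\mathbb{N}_0$. A node is atomic or decomposable according to whether $P$ is atomic or decomposable. The tree is a genuine tree (no merging of nodes). - Children of an atomic node $P+\ast n$: the couples $P'+\ast n$ with $P'$ a child of $P$, and $P+\ast n'$ with $0\le n'<n$. Nodes without children are terminals; they correspond to $\emptyset+\ast 0$, where $\emptyset$ is the empty position, and are losses. - For a decomposable node $v=P+\ast n$, $P=P_1+\dots+P_k$: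 for each $i\in\{1,\dots,k\}$, the node $x_i$ corresponds to $P_i+\ast j$, where $j$ is the least integer such that $P_i+\ast j$ has not been proved in the search below $v$. Thus the search starts with $P_i+\ast 0$, and as soon as $P_i+\ast j$ is proved it is replaced by a newly generated leaf $P_i+\ast(j+1)$. If $P_i+\ast j$ is disproved, then $gn(P_i)=j$ is known. As soon as $gn(P_1),\dots,gn(P_{k-1})$ are all known, the child $v'_k$ of $v$, corresponding to $P_k+\ast n'$ with $n'=n\oplus gn(P_1)\oplus\dots\oplus gn(P_{k-1})$, is generated. (The node $x_k$ is only used for evaluating $v$ before $v'_k$ is generated, and is never searched.) In a partially expanded tree, a non-terminal node is a leaf if it has not been expanded and internal otherwise. Expanding an atomic node generates all its children; expanding a decomposable node generates $x_1,\dots,x_k$. **Proof and disproof numbers.** Each node $v$ carries $pn(v),dn(v)\in\mathbb{N}_0\cup\{\infty\}$, determined by the currently expanded tree: - leaf: $pn(v)=dn(v)=1$; terminal: $pn(v)=\infty$, $dn(v)=0$; - internal atomic: $pn(v)=\min_c dn(c)$ and $dn(v)=\sum_c pn(c)$, over all children $c$ of $v$; - internal decomposable, $v'_k$ not generated: $pn(v)=dn(v)=\sum_{i=1}^k\min\{pn(x_i),dn(x_i)\}$; - internal decomposable, $v'_k$ generated: $pn(v)=pn(v'_k)$ and $dn(v)=dn(v'_k)$. A node is proved (value win) when $pn=0,\ dn=\infty$; disproved (value loss) when $pn=\infty,\ dn=0$; solved if proved or disproved. **Next node and MPN.** The next node of an unsolved internal node $v$ is: for atomic $v$, a child with the smallest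 disproof number (ties broken arbitrarily); for decomposable $v$ with $v'_k$ not generated, the node $x_i$ with the smallest $i\in\{1,\dots,k-1\}$ for which $gn(P_i)$ is not yet known; for decomposable $v$ with $v'_k$ generated, $v'_k$. If the root is unsolved, a most proving node (MPN) is a leaf reached from the root by repeatedly moving to the next node; if the root is solved there is no MPN. "The MPN is in the subtree of $v$" means that the root is unsolved and such a descent can pass through (or end at) $v$, i.e. each node on the path from the root to $v$, other than the root, is an admissible next node of its parent (ties being resolved in favour of this path). **DFPN with Grundy numbers.** The algorithm maintains a path $\mathcal{P}$ starting at the root $r$ and, for each $v$ on $\mathcal{P}$, thresholds $pt(v),dt(v),mt(v)\in\mathbb{N}_0\cup\{\infty\}$ and parameters $ps(v),ds(v)\in\mathbb{N}_0$. Initially $\mathcal{P}=(r)$ with $r$ expanded, $pt(r)=dt(r)=mt(r)=\infty$, $ps(r)=ds(r)=0$. Let $v$ be the last node of $\mathcal{P}$. If $v$ satisfies the three inequalities of the claim, the algorithm selects the next node $w$ of $v$, appends $w$ to $\mathcal{P}$, assigns thresholds to $w$ as below, and expands $w$ if it is a leaf. Otherwise it removes $v$ from $\mathcal{P}$ (backtracks), stopping if $v=r$. After each expansion all proof and disproof numbers along $\mathcal{P}$ are updated. Thus, while $w$ stays on $\mathcal{P}$, the expanded tree changes only within the subtree of $w$ (together with the generation of $P_i+\ast(j+1)$ or $v'_k$ below a decomposable parent $v$ at the moment $w$ becomes solved). The thresholds of $w$ are computed once, using the values of $pn,dn$ at the moment $w$ is selected in $v$, and remain fixed while $w$ stays on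 $\mathcal{P}$: - $v$ atomic, with $w'$ the child of $v$ having the second-lowest disproof number (put $dn(w')=\infty$ if $w$ is the only child): $$pt(w)=dt(v)-dn(v)+pn(w),\quad dt(w)=\min\{pt(v),\,dn(w')+1\},\quad mt(w)=mt(v),$$ $$ps(w)=ds(v)+dn(v)-pn(w),\quad ds(w)=ps(v).$$ - $v$ decomposable, $v'_k$ generated (so $w=v'_k$): $pt(w)=pt(v)$, $dt(w)=dt(v)$, $mt(w)=mt(v)$, $ps(w)=ps(v)$, $ds(w)=ds(v)$. - $v$ decomposable, $v'_k$ not generated: $$pt(w)=dt(w)=\infty,\quad mt(w)=t(v)-pn(v)+\min\{pn(w),dn(w)\},\quad ps(w)=ds(w)=0,$$ where $t(v)=\min\{pt(v),\ dt(v),\ mt(v)-\min\{ps(v),ds(v)\}\}$. Here $\infty$ plus or minus a finite number is $\infty$. *)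

theory Defs
  imports Main "HOL-Library.Extended_Nat" "HOL-Library.FSet" "HOL-Library.Sublist"
begin

section \<open>Impartial games\<close>

record 'p game =
  moves :: "'p \<Rightarrow> 'p set"
  empty_pos :: 'p
  combination :: "'p \<Rightarrow> 'p \<Rightarrow> 'p"

text \<open>
  Finitely many moves per position make Grundy numbers natural numbers and the sums below finite.
  The empty position is the only one without moves: the terminal nodes are the couples of the empty
  position and the empty heap.
\<close>

locale impartial_game =
  fixes G :: "('p, 'm) game_scheme" (structure)
  assumes finite_moves: "finite (moves G P)"
    and finite_play: "wf {(Q, P). Q \<in> moves G P}"
    and no_moves_iff: "moves G P = {} \<longleftrightarrow> P = empty_pos G"
    and combination_comm_monoid: "comm_monoid (combination G) (empty_pos G)"
    and moves_combination:
      "moves G (combination G P Q) =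
        (\<lambda>P'. combination G P' Q) ` moves G P \<union> (\<lambda>Q'. combination G P Q') ` moves G Q"

definition combination_list :: "('p, 'm) game_scheme \<Rightarrow> 'p list \<Rightarrow> 'p" where
  "combination_list G Ps = foldr (combination G) Ps (empty_pos G)"

definition decomposable :: "('p, 'm) game_scheme \<Rightarrow> 'p \<Rightarrow> bool" where
  "decomposable G P \<longleftrightarrow>
    (\<exists>Ps. length Ps \<ge> 2 \<and> empty_pos G \<notin> set Ps \<and> P = combination_list G Ps)"

abbreviation atomic :: "('p, 'm) game_scheme \<Rightarrow> 'p \<Rightarrow> bool" where
  "atomic G P \<equiv> \<not> decomposable G P"

definition gn :: "('p, 'm) game_scheme \<Rightarrow> 'p \<Rightarrow> nat" where
  "gn G = wfrec {(Q, P). Q \<in> moves G P} (\<lambda>g P. LEAST m. m \<notin> g ` moves G P)"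

lemma (in impartial_game) gn_eq: "gn G P = (LEAST m. m \<notin> gn G ` moves G P)"
proof -
  let ?R = "{(Q, P). Q \<in> moves G P}"
  have "gn G P = (LEAST m. m \<notin> cut (gn G) ?R P ` moves G P)"
    unfolding gn_def by (subst wfrec[OF finite_play]) simp
  also have "cut (gn G) ?R P ` moves G P = gn G ` moves G P"
    by (intro image_cong) (simp_all add: cut_def)
  finally show ?thesis .
qed


section \<open>The extended NAND tree\<close>

text \<open>
  The couple of a position \<open>P\<close> and the Nim heap with \<open>n\<close> objects is the pair \<open>(P, n)\<close>.  The list
  \<open>parts T P\<close> is the chosen decomposition \<open>[P\<^sub>1, \<dots>, P\<^sub>k]\<close> of a decomposable position \<open>P\<close>; list
  indices start at \<open>0\<close>, so \<open>parts T P ! i\<close> is \<open>P\<close> with subscript \<open>i + 1\<close>.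
\<close>

record 'p nand_tree = "'p game" +
  parts :: "'p \<Rightarrow> 'p list"
  root :: "'p \<times> nat"

locale extended_nand_tree = impartial_game T
  for T :: "'p nand_tree" (structure) +
  assumes parts: "decomposable T P \<Longrightarrow>
    length (parts T P) \<ge> 2 \<and> combination_list T (parts T P) = P \<and>
    (\<forall>Q\<in>set (parts T P). Q \<noteq> empty_pos T \<and> atomic T Q)"

text \<open>
  A node is the list of edges leading to it from the root, so distinct nodes may carry equal couples.
  Below a decomposable node, \<open>Component i j\<close> leads to the node of \<open>parts T P ! i\<close> with a heap of
  size \<open>j\<close> (one node for each \<open>j\<close>, so nodes already solved and replaced are kept), and \<open>Final\<close>
  leads to \<open>v'\<^sub>k\<close>.
\<close>

datatype 'p edge = Move "'p \<times> nat" | Component nat nat | Final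

type_synonym 'p node = "'p edge list"

fun target :: "'p nand_tree \<Rightarrow> 'p \<times> nat \<Rightarrow> 'p edge \<Rightarrow> 'p \<times> nat" where
  "target T _ (Move c) = c"
| "target T (P, n) (Component i j) = (parts T P ! i, j)"
| "target T (P, n) Final =
    (last (parts T P), fold xor (map (gn T) (butlast (parts T P))) n)"

definition couple :: "'p nand_tree \<Rightarrow> 'p node \<Rightarrow> 'p \<times> nat" where
  "couple T v = foldl (target T) (root T) v"

definition decomposable_node :: "'p nand_tree \<Rightarrow> 'p node \<Rightarrow> bool" where
  "decomposable_node T v \<longleftrightarrow> decomposable T (fst (couple T v))"

text \<open>The number \<open>k\<close> of parts of a decomposable node.\<close>

definition num_parts :: "'p nand_tree \<Rightarrow> 'p node \<Rightarrow> nat" where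
  "num_parts T v = length (parts T (fst (couple T v)))"

fun couple_children :: "'p nand_tree \<Rightarrow> 'p \<times> nat \<Rightarrow> ('p \<times> nat) set" where
  "couple_children T (P, n) = {(P', n) | P'. P' \<in> moves T P} \<union> {(P, n') | n'. n' < n}"

text \<open>Only used for atomic nodes.\<close>

definition children :: "'p nand_tree \<Rightarrow> 'p node \<Rightarrow> 'p node set" where
  "children T v = (\<lambda>c. v @ [Move c]) ` couple_children T (couple T v)"

definition terminal :: "'p nand_tree \<Rightarrow> 'p node \<Rightarrow> bool" where
  "terminal T v \<longleftrightarrow> \<not> decomposable_node T v \<and> children T v = {}"

text \<open>
  A partially expanded tree is given by the finite set \<open>E\<close> of its expanded nodes.  Which nodes have
  been generated, in particular which heap sizes \<open>j\<close> have been reached below a decomposable node, is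
  determined by \<open>E\<close>.
\<close>

definition leaf :: "'p nand_tree \<Rightarrow> 'p node fset \<Rightarrow> 'p node \<Rightarrow> bool" where
  "leaf T E v \<longleftrightarrow> \<not> terminal T v \<and> v |\<notin>| E"

definition internal :: "'p nand_tree \<Rightarrow> 'p node fset \<Rightarrow> 'p node \<Rightarrow> bool" where
  "internal T E v \<longleftrightarrow> \<not> terminal T v \<and> v |\<in>| E"


section \<open>Proof and disproof numbers\<close>

text \<open>
  The pair of the proof and the disproof number; \<open>(0, \<infinity>)\<close> is a proved node and \<open>(\<infinity>, 0)\<close> a disproved
  one.  The equations in terms of \<open>pn\<close> and \<open>dn\<close> are \<open>pn_dn_leaf\<close> to \<open>pn_dn_decomposable_final\<close> below.
\<close>

function pdn :: "'p nand_tree \<Rightarrow> 'p node fset \<Rightarrow> 'p node \<Rightarrow> enat \<times> enat" where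
  "pdn T E v =
    (if terminal T v then (\<infinity>, 0)
     else if v |\<notin>| E then (1, 1)
     else if decomposable_node T v then
       (let x = (\<lambda>i. v @ [Component i (LEAST j. pdn T E (v @ [Component i j]) \<noteq> (0, \<infinity>))])
        in if \<forall>i < num_parts T v - 1. pdn T E (x i) = (\<infinity>, 0)
           then pdn T E (v @ [Final])
           else let s = (\<Sum>i < num_parts T v. min (fst (pdn T E (x i))) (snd (pdn T E (x i))))
                in (s, s))
     else (INF c\<in>children T v. snd (pdn T E c), \<Sum>c\<in>children T v. fst (pdn T E c)))"
  by pat_completeness auto

lemma card_extensions_less:
  assumes "v |\<in>| E"
  shows "card {u. u |\<in>| E \<and> prefix (v @ [e]) u} < card {u. u |\<in>| E \<and> prefix v u}"
proof (rule psubset_card_mono)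
  show "finite {u. u |\<in>| E \<and> prefix v u}"
    by (rule finite_subset[of _ "fset E"]) auto
  have "\<not> prefix (v @ [e]) v" "prefix v v"
    by (auto simp: prefix_def)
  then show "{u. u |\<in>| E \<and> prefix (v @ [e]) u} \<subset> {u. u |\<in>| E \<and> prefix v u}"
    using assms by (blast dest: append_prefixD)
qed

termination pdn
  by (relation "measure (\<lambda>(T, E, v). card {u. u |\<in>| E \<and> prefix v u})")
    (auto simp: children_def intro!: card_extensions_less)

declare pdn.simps [simp del]

definition pn :: "'p nand_tree \<Rightarrow> 'p node fset \<Rightarrow> 'p node \<Rightarrow> enat" where
  "pn T E v = fst (pdn T E v)"

definition dn :: "'p nand_tree \<Rightarrow> 'p node fset \<Rightarrow> 'p node \<Rightarrow> enat" where
  "dn T E v = snd (pdn T E v)"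

definition proved :: "'p nand_tree \<Rightarrow> 'p node fset \<Rightarrow> 'p node \<Rightarrow> bool" where
  "proved T E v \<longleftrightarrow> pn T E v = 0 \<and> dn T E v = \<infinity>"

definition disproved :: "'p nand_tree \<Rightarrow> 'p node fset \<Rightarrow> 'p node \<Rightarrow> bool" where
  "disproved T E v \<longleftrightarrow> pn T E v = \<infinity> \<and> dn T E v = 0"

definition solved :: "'p nand_tree \<Rightarrow> 'p node fset \<Rightarrow> 'p node \<Rightarrow> bool" where
  "solved T E v \<longleftrightarrow> proved T E v \<or> disproved T E v"

text \<open>The node \<open>x\<close> with subscript \<open>i + 1\<close> below the decomposable node \<open>v\<close>.\<close>

definition component_node :: "'p nand_tree \<Rightarrow> 'p node fset \<Rightarrow> 'p node \<Rightarrow> nat \<Rightarrow> 'p node" where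
  "component_node T E v i = v @ [Component i (LEAST j. \<not> proved T E (v @ [Component i j]))]"

definition gn_known :: "'p nand_tree \<Rightarrow> 'p node fset \<Rightarrow> 'p node \<Rightarrow> nat \<Rightarrow> bool" where
  "gn_known T E v i \<longleftrightarrow> disproved T E (component_node T E v i)"

definition final_generated :: "'p nand_tree \<Rightarrow> 'p node fset \<Rightarrow> 'p node \<Rightarrow> bool" where
  "final_generated T E v \<longleftrightarrow> (\<forall>i < num_parts T v - 1. gn_known T E v i)"

lemma pn_dn_leaf: "leaf T E v \<Longrightarrow> pn T E v = 1 \<and> dn T E v = 1"
  by (simp add: pn_def dn_def leaf_def pdn.simps[of T E v])

lemma pn_dn_terminal: "terminal T v \<Longrightarrow> pn T E v = \<infinity> \<and> dn T E v = 0"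
  by (simp add: pn_def dn_def pdn.simps[of T E v])

lemma pn_dn_atomic:
  assumes "internal T E v" "\<not> decomposable_node T v"
  shows "pn T E v = (INF c\<in>children T v. dn T E c)" "dn T E v = (\<Sum>c\<in>children T v. pn T E c)"
  using assms by (simp_all add: pn_def dn_def internal_def pdn.simps[of T E v])

lemma proved_pdn: "proved T E v \<longleftrightarrow> pdn T E v = (0, \<infinity>)"
  by (auto simp: proved_def pn_def dn_def prod_eq_iff)

lemma disproved_pdn: "disproved T E v \<longleftrightarrow> pdn T E v = (\<infinity>, 0)"
  by (auto simp: disproved_def pn_def dn_def prod_eq_iff)

lemma pn_dn_decomposable:
  assumes "internal T E v" "decomposable_node T v" "\<not> final_generated T E v"
  shows "pn T E v = (\<Sum>i < num_parts T v.
      min (pn T E (component_node T E v i)) (dn T E (component_node T E v i)))"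
    and "dn T E v = pn T E v"
  using assms
  by (auto simp: pn_def dn_def internal_def pdn.simps[of T E v] final_generated_def
      gn_known_def component_node_def proved_pdn disproved_pdn Let_def)

lemma pn_dn_decomposable_final:
  assumes "internal T E v" "decomposable_node T v" "final_generated T E v"
  shows "pn T E v = pn T E (v @ [Final])" "dn T E v = dn T E (v @ [Final])"
  using assms
  by (simp_all add: pn_def dn_def internal_def pdn.simps[of T E v] final_generated_def
      gn_known_def component_node_def proved_pdn disproved_pdn Let_def)


section \<open>The most proving node\<close>

text \<open>A relation, because ties are broken arbitrarily.\<close>

definition next_node :: "'p nand_tree \<Rightarrow> 'p node fset \<Rightarrow> 'p node \<Rightarrow> 'p node \<Rightarrow> bool" where
  "next_node T E v w \<longleftrightarrow> internal T E v \<and> \<not> solved T E v \<and>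
    (if \<not> decomposable_node T v
     then w \<in> children T v \<and> (\<forall>c\<in>children T v. dn T E w \<le> dn T E c)
     else if final_generated T E v
     then w = v @ [Final]
     else \<exists>i < num_parts T v - 1. w = component_node T E v i \<and>
       \<not> gn_known T E v i \<and> (\<forall>i' < i. gn_known T E v i'))"

definition most_proving_node :: "'p nand_tree \<Rightarrow> 'p node fset \<Rightarrow> 'p node \<Rightarrow> bool" where
  "most_proving_node T E m \<longleftrightarrow> \<not> solved T E [] \<and> (next_node T E)\<^sup>*\<^sup>* [] m \<and> leaf T E m"

text \<open>
  Some descent from the root to a most proving node passes through, or ends at, \<open>v\<close>.  As every node
  has only one parent, the descent to \<open>v\<close> consists of the nodes on the path from the root to \<open>v\<close>.
\<close>

definition mpn_in_subtree :: "'p nand_tree \<Rightarrow> 'p node fset \<Rightarrow> 'p node \<Rightarrow> bool" where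
  "mpn_in_subtree T E v \<longleftrightarrow>
    (\<exists>m. most_proving_node T E m \<and> (next_node T E)\<^sup>*\<^sup>* [] v \<and> (next_node T E)\<^sup>*\<^sup>* v m)"


section \<open>DFPN with Grundy numbers\<close>

record 'p frame =
  node :: "'p node"
  pt :: enat
  dt :: enat
  mt :: enat
  ps :: nat
  ds :: nat

definition within_thresholds :: "'p nand_tree \<Rightarrow> 'p node fset \<Rightarrow> 'p frame \<Rightarrow> bool" where
  "within_thresholds T E f \<longleftrightarrow>
    pn T E (node f) < pt f \<and> dn T E (node f) < dt f \<and>
    min (pn T E (node f) + enat (ps f)) (dn T E (node f) + enat (ds f)) < mt f"

text \<open>
  The frame of the node \<open>w\<close> selected in the node of the frame \<open>f\<close>.  Subtraction is only applied
  where the result is not negative, and \<open>the_enat\<close> only to finite numbers: \<open>w\<close> is selected when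
  \<open>within_thresholds T E f\<close> holds, and then \<open>w\<close> is unsolved and \<open>pn w \<le> dn v\<close> for atomic \<open>v\<close>.
  If \<open>w\<close> is the only child, then the infimum over the other children is \<open>\<infinity>\<close>.
\<close>

definition child_frame :: "'p nand_tree \<Rightarrow> 'p node fset \<Rightarrow> 'p frame \<Rightarrow> 'p node \<Rightarrow> 'p frame" where
  "child_frame T E f w =
    (let v = node f in
     if \<not> decomposable_node T v then
       \<lparr>node = w,
        pt = dt f - dn T E v + pn T E w,
        dt = min (pt f) ((INF c\<in>children T v - {w}. dn T E c) + 1),
        mt = mt f,
        ps = ds f + the_enat (dn T E v) - the_enat (pn T E w),
        ds = ps f\<rparr>
     else if final_generated T E v then f\<lparr>node := w\<rparr>
     else
       let t = min (pt f) (min (dt f) (mt f - enat (min (ps f) (ds f)))) in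
       \<lparr>node = w,
        pt = \<infinity>,
        dt = \<infinity>,
        mt = t - pn T E v + min (pn T E w) (dn T E w),
        ps = 0,
        ds = 0\<rparr>)"

text \<open>
  A state consists of the expanded nodes and the explored path, root first.  Appending a node to the
  path and expanding it are separate steps, so the moment between the two is also a state.
  Backtracking from the root leaves the empty path, from which no step is possible.
\<close>

type_synonym 'p state = "'p node fset \<times> 'p frame list"

definition initial_state :: "'p state" where
  "initial_state = ({|[]|}, [\<lparr>node = [], pt = \<infinity>, dt = \<infinity>, mt = \<infinity>, ps = 0, ds = 0\<rparr>])"

inductive dfpn_step :: "'p nand_tree \<Rightarrow> 'p state \<Rightarrow> 'p state \<Rightarrow> bool" for T where
  expand: "leaf T E (node f) \<Longrightarrow>
    dfpn_step T (E, fs @ [f]) (finsert (node f) E, fs @ [f])"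
| select: "\<not> leaf T E (node f) \<Longrightarrow> within_thresholds T E f \<Longrightarrow> next_node T E (node f) w \<Longrightarrow>
    dfpn_step T (E, fs @ [f]) (E, fs @ [f, child_frame T E f w])"
| backtrack: "\<not> leaf T E (node f) \<Longrightarrow> \<not> within_thresholds T E f \<Longrightarrow>
    dfpn_step T (E, fs @ [f]) (E, fs)"

definition dfpn_reachable :: "'p nand_tree \<Rightarrow> 'p state \<Rightarrow> bool" where
  "dfpn_reachable T s \<longleftrightarrow> (dfpn_step T)\<^sup>*\<^sup>* initial_state s"

end

theory Submission
  imports Defs
begin

text \<open>
  Along the path, the descent to a most proving node reaches a selected node \<open>w\<close> iff it reaches its
  parent \<open>v\<close> and \<open>w\<close> is still an admissible next node of \<open>v\<close>.  The thresholds of \<open>w\<close> translate the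
  thresholds of \<open>v\<close> together with this admissibility.  At an atomic \<open>v\<close>, subtracting from \<open>dn v\<close> the
  proof numbers of the siblings turns a bound on \<open>dn v\<close> into one on \<open>pn w\<close>, and \<open>dn w < dn w' + 1\<close>,
  with \<open>w'\<close> the best sibling, says that \<open>w\<close> still has the least disproof number.  At a decomposable \<open>v\<close> whose final child is not
  generated, \<open>pn v = dn v\<close>, so the three bounds on \<open>v\<close> become the single bound \<open>t v\<close>, and \<open>w\<close> is a
  next node exactly as long as it is unsolved.
\<close>

section \<open>Dependence of the numbers on the expanded tree\<close>

text \<open>The recursion for \<open>pdn\<close> only visits extensions of \<open>v\<close>.
  Expansions elsewhere therefore leave its value alone, which keeps the siblings of a searched node
  constant.\<close>

lemma pdn_cong:
  assumes "\<And>u. prefix v u \<Longrightarrow> u |\<in>| E \<longleftrightarrow> u |\<in>| E'"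
  shows "pdn T E v = pdn T E' v"
  using assms
proof (induction "card {u. u |\<in>| E \<and> prefix v u}" arbitrary: v rule: less_induct)
  case less
  show ?case
  proof (cases "v |\<in>| E")
    case True
    then have eq: "pdn T E (v @ [e]) = pdn T E' (v @ [e])" for e
      using less.prems by (intro less.hyps card_extensions_less) (auto dest: append_prefixD)
    then have "(INF c\<in>children T v. snd (pdn T E c)) = (INF c\<in>children T v. snd (pdn T E' c))"
      and "(\<Sum>c\<in>children T v. fst (pdn T E c)) = (\<Sum>c\<in>children T v. fst (pdn T E' c))"
      by (auto simp: children_def intro!: INF_cong sum.cong)
    then show ?thesis
      using True less.prems[of v]
      unfolding pdn.simps[of T E v] pdn.simps[of T E' v] Let_def eq by simp
  next
    case False
    then show ?thesis
      using less.prems[of v] by (simp add: pdn.simps[of T E v] pdn.simps[of T E' v])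
  qed
qed

lemma pn_dn_cong:
  assumes "\<And>u. prefix v u \<Longrightarrow> u |\<in>| E \<longleftrightarrow> u |\<in>| E'"
  shows "pn T E v = pn T E' v" "dn T E v = dn T E' v"
  using pdn_cong[OF assms] by (simp_all add: pn_def dn_def)

lemma pn_dn_not_expanded:
  "v |\<notin>| E \<Longrightarrow> pn T E v = 1 \<and> dn T E v = 1 \<or> pn T E v = \<infinity> \<and> dn T E v = 0"
  using pn_dn_leaf[of T E v] pn_dn_terminal[of T v E] by (cases "terminal T v") (simp_all add: leaf_def)

text \<open>Only finitely many nodes are expanded and an unexpanded node is never proved. Hence the
  \<open>LEAST\<close> in \<open>component_node\<close> is always attained.\<close>

lemma ex_component_not_proved: "\<exists>j. \<not> proved T E (v @ [Component i j])"
proof -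
  have "infinite (range (\<lambda>j. v @ [Component i j]))"
    by (rule range_inj_infinite) (simp add: inj_on_def)
  then have "\<not> range (\<lambda>j. v @ [Component i j]) \<subseteq> fset E"
    using finite_fset finite_subset by blast
  then obtain j where "v @ [Component i j] |\<notin>| E"
    by blast
  then have "\<not> proved T E (v @ [Component i j])"
    using pn_dn_not_expanded[of "v @ [Component i j]" E T] by (auto simp: proved_def)
  then show ?thesis ..
qed

lemma component_node_not_proved: "\<not> proved T E (component_node T E v i)"
  unfolding component_node_def by (rule LeastI_ex[OF ex_component_not_proved])

lemma not_gn_known_iff: "\<not> gn_known T E v i \<longleftrightarrow> \<not> solved T E (component_node T E v i)"
  using component_node_not_proved by (auto simp: gn_known_def solved_def)

lemma next_node_extends: "next_node T E v w \<Longrightarrow> \<exists>e. w = v @ [e]"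
  by (auto simp: next_node_def children_def component_node_def split: if_splits)

lemma node_child_frame [simp]: "node (child_frame T E f w) = w"
  by (simp add: child_frame_def Let_def)

section \<open>Arithmetic of extended naturals\<close>

lemma sum_enat_eq_infinity_iff:
  "finite A \<Longrightarrow> (\<Sum>x\<in>A. f x) = (\<infinity>::enat) \<longleftrightarrow> (\<exists>x\<in>A. f x = \<infinity>)"
  by (induction A rule: finite_induct) (auto simp: plus_eq_infty_iff_enat)

text \<open>Truncation does no harm under a strict bound: for \<open>c\<close> at most
  \<open>s\<close> both sides are false.\<close>

lemma less_enat_diff_iff:
  fixes a c :: enat
  shows "a < c - enat s \<longleftrightarrow> a + enat s < c"
  by (cases a; cases c) auto

text \<open>The form of the threshold \<open>dt\<close> at an atomic parent. The added one admits
  ties with the best sibling.\<close>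

lemma less_min_plus_one_iff:
  fixes a b c :: enat
  shows "a < min c (b + 1) \<longleftrightarrow> a < c \<and> a \<le> b"
  by (cases a; cases b; cases c) (auto simp: one_enat_def)

lemma INF_remove_enat:
  fixes f :: "'a \<Rightarrow> enat"
  assumes "x \<in> A"
  shows "(INF a\<in>A. f a) = min (f x) (INF a\<in>A - {x}. f a)"
  using assms by (metis INF_insert inf_min insert_Diff)

context extended_nand_tree
begin

section \<open>Possible values of proof and disproof numbers\<close>

lemma finite_children: "finite (children T v)"
proof -
  have "couple_children T (P, n) = (\<lambda>P'. (P', n)) ` moves T P \<union> Pair P ` {..<n}" for P n
    by auto
  then have "finite (couple_children T c)" for c
    using finite_moves by (cases c) simp
  then show ?thesis
    by (simp add: children_def)
qed

text \<open>A non-terminal atomic node has children, and a nonempty set of extended naturals attains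
  its infimum.\<close>

lemma ex_child_dn_eq_pn:
  assumes "internal T E v" "\<not> decomposable_node T v"
  shows "\<exists>c\<in>children T v. dn T E c = pn T E v"
proof -
  have "dn T E ` children T v \<noteq> {}"
    using assms by (simp add: internal_def terminal_def)
  then have "Inf (dn T E ` children T v) \<in> dn T E ` children T v"
    by (metis Inf_enat_def LeastI_ex ex_in_conv)
  then show ?thesis
    by (auto simp: pn_dn_atomic[OF assms])
qed

text \<open>Excludes mixed pairs, so that being unsolved amounts to both numbers being
  finite.\<close>

lemma pn_dn_cases:
  "proved T E v \<or> disproved T E v \<or>
    0 < pn T E v \<and> pn T E v < \<infinity> \<and> 0 < dn T E v \<and> dn T E v < \<infinity>"
proof (induction "card {u. u |\<in>| E \<and> prefix v u}" arbitrary: v rule: less_induct)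
  case less
  show ?case
  proof (cases "internal T E v")
    case False
    then show ?thesis
      using pn_dn_leaf[of T E v] pn_dn_terminal[of T v E]
      by (cases "terminal T v") (simp_all add: internal_def leaf_def disproved_def one_enat_def zero_enat_def)
  next
    case True
    then have IH: "proved T E (v @ [e]) \<or> disproved T E (v @ [e]) \<or>
        0 < pn T E (v @ [e]) \<and> pn T E (v @ [e]) < \<infinity> \<and>
        0 < dn T E (v @ [e]) \<and> dn T E (v @ [e]) < \<infinity>" for e
      by (intro less.hyps card_extensions_less) (simp add: internal_def)
    consider (atomic) "\<not> decomposable_node T v"
      | (pending) "decomposable_node T v" "\<not> final_generated T E v"
      | (final) "decomposable_node T v" "final_generated T E v"
      by blast
    then show ?thesis
    proof cases
      case atomic
      note eqs = pn_dn_atomic[OF True atomic]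
      have ch: "c \<in> children T v \<Longrightarrow> proved T E c \<or> disproved T E c \<or>
        0 < pn T E c \<and> pn T E c < \<infinity> \<and> 0 < dn T E c \<and> dn T E c < \<infinity>" for c
        using IH by (auto simp: children_def)
      have inf: "dn T E v = \<infinity> \<longleftrightarrow> (\<exists>c\<in>children T v. pn T E c = \<infinity>)"
        by (simp add: eqs sum_enat_eq_infinity_iff finite_children)
      have zero: "dn T E v = 0 \<longleftrightarrow> (\<forall>c\<in>children T v. pn T E c = 0)"
        by (simp add: eqs finite_children)
      obtain c where c: "c \<in> children T v" "pn T E v = dn T E c"
        using ex_child_dn_eq_pn[OF True atomic] by metis
      have le: "pn T E v \<le> dn T E d" if "d \<in> children T v" for d
        using that by (simp add: eqs INF_lower)
      \<comment> \<open>The NAND rule: one disproved child proves the node, all children proved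
        disprove it, and otherwise both numbers are finite and positive.\<close>
      show ?thesis
      proof (cases "\<exists>d\<in>children T v. disproved T E d")
        case True
        then have "proved T E v"
          using le inf by (metis disproved_def le_zero_eq proved_def)
        then show ?thesis ..
      next
        case nd: False
        show ?thesis
        proof (cases "\<forall>d\<in>children T v. proved T E d")
          case True
          then have "disproved T E v"
            using c zero by (auto simp: proved_def disproved_def)
          then show ?thesis by blast
        next
          case False
          then obtain d where "d \<in> children T v" "\<not> proved T E d" by blast
          then have d: "d \<in> children T v" "0 < pn T E d" "dn T E d < \<infinity>"
            using nd ch by blast+
          have "pn T E v < \<infinity>"
            using le[OF d(1)] d(3) by (rule le_less_trans)
          moreover have "0 < pn T E v"
            using ch[OF c(1)] nd c by (auto simp: proved_def)
          moreover have "0 < dn T E v"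
            using d(1,2) zero by (auto simp: zero_less_iff_neq_zero)
          moreover have "pn T E c \<noteq> \<infinity>" if "c \<in> children T v" for c
            using ch[OF that] nd that by (auto simp: proved_def zero_enat_def)
          then have "dn T E v < \<infinity>"
            using inf by (metis enat_ord_simps(6) enat_ord_simps(4))
          ultimately show ?thesis by blast
        qed
      qed
    next
      case pending
      note eqs = pn_dn_decomposable[OF True pending]
      let ?x = "component_node T E v"
      have x: "proved T E (?x i) \<or> disproved T E (?x i) \<or>
        0 < pn T E (?x i) \<and> pn T E (?x i) < \<infinity> \<and> 0 < dn T E (?x i) \<and> dn T E (?x i) < \<infinity>" for i
        using IH by (simp add: component_node_def)
      \<comment> \<open>A solved component contributes 0 to the sum, an unsolved one a finite
        positive number.\<close>
      have "min (pn T E (?x i)) (dn T E (?x i)) \<noteq> \<infinity>" for i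
        using x[of i] by (auto simp: min_def proved_def disproved_def zero_enat_def)
      then have "pn T E v \<noteq> \<infinity>"
        by (simp add: eqs sum_enat_eq_infinity_iff)
      \<comment> \<open>An unknown Grundy number supplies a nonzero summand.\<close>
      obtain i where i: "i < num_parts T v - 1" "\<not> solved T E (?x i)"
        using pending by (auto simp: final_generated_def not_gn_known_iff)
      then have "min (pn T E (?x i)) (dn T E (?x i)) \<noteq> 0"
        using x[of i] by (auto simp: min_def solved_def)
      moreover have "i \<in> {..<num_parts T v}"
        using i(1) by simp
      ultimately have "pn T E v \<noteq> 0"
        unfolding eqs(1) sum_eq_0_iff[OF finite_lessThan] by blast
      then show ?thesis
        using \<open>pn T E v \<noteq> \<infinity>\<close> by (simp add: eqs(2) zero_less_iff_neq_zero)
    next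
      case final
      then show ?thesis
        using IH[of Final] pn_dn_decomposable_final[OF True final]
        by (simp add: proved_def disproved_def)
    qed
  qed
qed

lemma not_solved_iff: "\<not> solved T E v \<longleftrightarrow> pn T E v \<noteq> \<infinity> \<and> dn T E v \<noteq> \<infinity>"
  using pn_dn_cases[of E v] by (auto simp: solved_def proved_def disproved_def zero_enat_def)

lemma min_pn_dn_finite: "min (pn T E v) (dn T E v) \<noteq> \<infinity>"
  using pn_dn_cases[of E v] by (auto simp: min_def proved_def disproved_def zero_enat_def)

section \<open>Next nodes and descents\<close>

text \<open>At an atomic \<open>v\<close>, \<open>dn w\<close> equals \<open>pn v\<close> and
  \<open>pn w\<close> is a summand of \<open>dn v\<close>, so both are finite. At a decomposable one
  the selected component has an unknown Grundy number, or \<open>w\<close> shares the numbers of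
  \<open>v\<close>.\<close>

lemma next_node_not_solved:
  assumes "next_node T E v w"
  shows "\<not> solved T E w"
proof -
  have v: "internal T E v" "\<not> solved T E v"
    using assms by (simp_all add: next_node_def)
  consider (atomic) "\<not> decomposable_node T v"
    | (pending) "decomposable_node T v" "\<not> final_generated T E v"
    | (final) "decomposable_node T v" "final_generated T E v"
    by blast
  then show ?thesis
  proof cases
    case atomic
    note eqs = pn_dn_atomic[OF v(1) atomic]
    have w: "w \<in> children T v" "\<forall>c\<in>children T v. dn T E w \<le> dn T E c"
      using assms atomic by (simp_all add: next_node_def)
    then have "dn T E w = pn T E v"
      unfolding eqs by (metis INF_greatest INF_lower order_antisym)
    moreover have "pn T E w \<noteq> \<infinity>"
      using v w by (auto simp: not_solved_iff eqs sum_enat_eq_infinity_iff finite_children)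
    ultimately show ?thesis
      using v(2) by (simp add: not_solved_iff)
  next
    case pending
    then show ?thesis
      using assms by (auto simp: next_node_def not_gn_known_iff)
  next
    case final
    then show ?thesis
      using assms pn_dn_decomposable_final[OF v(1) final] by (simp add: next_node_def not_solved_iff)
  qed
qed

lemma ex_next_node:
  assumes "internal T E v" "\<not> solved T E v"
  shows "\<exists>w. next_node T E v w"
proof -
  consider (atomic) "\<not> decomposable_node T v"
    | (pending) "decomposable_node T v" "\<not> final_generated T E v"
    | (final) "decomposable_node T v" "final_generated T E v"
    by blast
  then show ?thesis
  proof cases
    case atomic
    then obtain w where "w \<in> children T v" "dn T E w = pn T E v"
      using ex_child_dn_eq_pn assms(1) by blast
    then have "w \<in> children T v" "\<forall>c\<in>children T v. dn T E w \<le> dn T E c"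
      by (simp_all add: pn_dn_atomic[OF assms(1) atomic] INF_lower)
    then show ?thesis
      using assms atomic by (auto simp: next_node_def)
  next
    case pending
    then have "\<exists>i. i < num_parts T v - 1 \<and> \<not> gn_known T E v i"
      by (auto simp: final_generated_def)
    then obtain i where "i < num_parts T v - 1 \<and> \<not> gn_known T E v i"
      and "\<forall>i' < i. \<not> (i' < num_parts T v - 1 \<and> \<not> gn_known T E v i')"
      unfolding exists_least_iff[of "\<lambda>i. i < num_parts T v - 1 \<and> \<not> gn_known T E v i"] by blast
    then have "next_node T E v (component_node T E v i)"
      using assms pending by (auto simp: next_node_def)
    then show ?thesis ..
  next
    case final
    then show ?thesis
      using assms by (simp add: next_node_def)
  qed
qed

text \<open>An unsolved node is not terminal, so the descent can only stop at a leaf. It does stop,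
  since each step leaves fewer expanded nodes below.\<close>

lemma ex_descent_to_leaf:
  "\<not> solved T E v \<Longrightarrow> \<exists>m. (next_node T E)\<^sup>*\<^sup>* v m \<and> leaf T E m"
proof (induction "card {u. u |\<in>| E \<and> prefix v u}" arbitrary: v rule: less_induct)
  case less
  show ?case
  proof (cases "leaf T E v")
    case False
    moreover have "\<not> terminal T v"
      using less.prems pn_dn_terminal[of T v E] by (auto simp: not_solved_iff)
    ultimately have int: "internal T E v"
      by (simp add: leaf_def internal_def)
    then obtain w where w: "next_node T E v w"
      using ex_next_node less.prems by blast
    then obtain e where "w = v @ [e]"
      using next_node_extends by blast
    then have "\<exists>m. (next_node T E)\<^sup>*\<^sup>* w m \<and> leaf T E m"
      using int next_node_not_solved[OF w]
      by (intro less.hyps) (auto simp: internal_def intro: card_extensions_less)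
    then show ?thesis
      using w by (meson converse_rtranclp_into_rtranclp)
  qed auto
qed

lemma next_nodes_not_solved:
  "(next_node T E)\<^sup>*\<^sup>* v w \<Longrightarrow> \<not> solved T E v \<Longrightarrow> \<not> solved T E w"
  by (induction rule: rtranclp_induct) (auto dest: next_node_not_solved)

text \<open>Being unsolved passes down to next nodes, so a descent that has reached \<open>v\<close>
  can always be completed to a leaf.\<close>

lemma mpn_in_subtree_iff:
  "mpn_in_subtree T E v \<longleftrightarrow> \<not> solved T E [] \<and> (next_node T E)\<^sup>*\<^sup>* [] v"
proof
  assume "\<not> solved T E [] \<and> (next_node T E)\<^sup>*\<^sup>* [] v"
  moreover from this obtain m where "(next_node T E)\<^sup>*\<^sup>* v m" "leaf T E m"
    using ex_descent_to_leaf next_nodes_not_solved by blast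
  ultimately show "mpn_in_subtree T E v"
    unfolding mpn_in_subtree_def most_proving_node_def by (meson rtranclp_trans)
qed (auto simp: mpn_in_subtree_def most_proving_node_def)

text \<open>Each step adds exactly one edge, so the last step of a descent to \<open>v @ [e]\<close>
  starts at \<open>v\<close>.\<close>

lemma mpn_in_subtree_append:
  "mpn_in_subtree T E (v @ [e]) \<longleftrightarrow> mpn_in_subtree T E v \<and> next_node T E v (v @ [e])"
proof
  assume "mpn_in_subtree T E (v @ [e])"
  then have r: "\<not> solved T E []" "(next_node T E)\<^sup>*\<^sup>* [] (v @ [e])"
    by (simp_all add: mpn_in_subtree_iff)
  from r(2) obtain u where "(next_node T E)\<^sup>*\<^sup>* [] u" "next_node T E u (v @ [e])"
    by (cases rule: rtranclp.cases) auto
  moreover from this have "u = v"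
    using next_node_extends by fastforce
  ultimately show "mpn_in_subtree T E v \<and> next_node T E v (v @ [e])"
    using r(1) by (simp add: mpn_in_subtree_iff)
qed (auto simp: mpn_in_subtree_iff)

text \<open>
  While the selected node stays on the path, its thresholds depend on the tree \<open>E\<^sub>0\<close> of the moment of
  selection only through the values of its siblings, which are the same in the current tree \<open>E\<close>.
\<close>

lemma within_thresholds_child_frame:
  assumes sel: "within_thresholds T E\<^sub>0 f" "next_node T E\<^sub>0 (node f) w"
    and sub: "E\<^sub>0 |\<subseteq>| E"
    and ext: "\<And>u. u |\<in>| E \<Longrightarrow> u |\<notin>| E\<^sub>0 \<Longrightarrow> prefix w u"
  shows "within_thresholds T E (child_frame T E\<^sub>0 f w) \<longleftrightarrow>
    within_thresholds T E f \<and> next_node T E (node f) w"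
proof -
  let ?v = "node f" and ?g = "child_frame T E\<^sub>0 f w"
  obtain e where w: "w = ?v @ [e]"
    using next_node_extends sel(2) by blast
  have int\<^sub>0: "internal T E\<^sub>0 ?v" and unsolved\<^sub>0: "\<not> solved T E\<^sub>0 ?v"
    using sel(2) by (simp_all add: next_node_def)
  then have int: "internal T E ?v"
    using sub by (auto simp: internal_def)
  \<comment> \<open>Subtrees below different edges are disjoint, and everything expanded since the
    selection lies below \<open>w\<close>.\<close>
  have pn_eq: "pn T E (?v @ [e']) = pn T E\<^sub>0 (?v @ [e'])"
    and dn_eq: "dn T E (?v @ [e']) = dn T E\<^sub>0 (?v @ [e'])" if "e' \<noteq> e" for e'
  proof -
    have agree: "u |\<in>| E \<longleftrightarrow> u |\<in>| E\<^sub>0" if "prefix (?v @ [e']) u" for u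
    proof -
      have "\<not> prefix w u"
        using that \<open>e' \<noteq> e\<close> by (auto simp: w prefix_def)
      then show ?thesis
        using sub ext by blast
    qed
    show "pn T E (?v @ [e']) = pn T E\<^sub>0 (?v @ [e'])"
      "dn T E (?v @ [e']) = dn T E\<^sub>0 (?v @ [e'])"
      by (rule pn_dn_cong, rule agree, assumption)+
  qed
  \<comment> \<open>Numbers strictly below a threshold are finite. The thresholds thus absorb the
    unsolvedness required by \<open>next_node\<close>.\<close>
  have within_unsolved: "\<not> solved T E ?v" if "within_thresholds T E f"
    using that unfolding within_thresholds_def not_solved_iff by (metis enat_ord_simps(6))
  consider (atomic) "\<not> decomposable_node T ?v"
    | (pending) "decomposable_node T ?v" "\<not> final_generated T E\<^sub>0 ?v"
    | (final) "decomposable_node T ?v" "final_generated T E\<^sub>0 ?v"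
    by blast
  then show ?thesis
  proof cases
    case atomic
    note eqs\<^sub>0 = pn_dn_atomic[OF int\<^sub>0 atomic]
    note eqs = pn_dn_atomic[OF int atomic]
    let ?C = "children T ?v - {w}"
    have child: "w \<in> children T ?v"
      using sel(2) atomic by (simp add: next_node_def)
    have sib: "pn T E c = pn T E\<^sub>0 c" "dn T E c = dn T E\<^sub>0 c" if "c \<in> ?C" for c
      using that pn_eq dn_eq by (auto simp: children_def w)
    \<comment> \<open>The best disproof number among the siblings, \<open>\<infinity>\<close> if
      there are none.\<close>
    define m where "m = (INF c\<in>?C. dn T E c)"
    have m: "(INF c\<in>?C. dn T E\<^sub>0 c) = m"
      unfolding m_def using sib by (intro INF_cong) auto
    have dn\<^sub>0: "dn T E\<^sub>0 ?v = pn T E\<^sub>0 w + (\<Sum>c\<in>?C. pn T E c)"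
      unfolding eqs\<^sub>0 sum.remove[OF finite_children child] using sib by simp
    moreover have "dn T E\<^sub>0 ?v \<noteq> \<infinity>"
      using unsolved\<^sub>0 by (simp add: not_solved_iff)
    \<comment> \<open>\<open>S\<close> is the constant share of the siblings in \<open>dn v\<close>,
      finite because \<open>v\<close> was unsolved at the selection.\<close>
    ultimately obtain S p\<^sub>0 where S: "(\<Sum>c\<in>?C. pn T E c) = enat S" and p\<^sub>0: "pn T E\<^sub>0 w = enat p\<^sub>0"
      by (metis not_infinity_eq plus_eq_infty_iff_enat)
    have dn: "dn T E ?v = pn T E w + enat S"
      unfolding eqs sum.remove[OF finite_children child] S ..
    have pn: "pn T E ?v = min (dn T E w) m"
      unfolding eqs m_def by (rule INF_remove_enat[OF child])
    \<comment> \<open>Ensures that \<open>dt f - dn v + pn w\<close>, taken at the selection, is not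
      distorted by truncation and equals \<open>dt f - S\<close>.\<close>
    have lt: "dn T E\<^sub>0 ?v < dt f"
      using sel(1) by (simp add: within_thresholds_def)
    have "pt ?g = dt f - enat S"
      using lt atomic by (cases "dt f") (simp_all add: child_frame_def Let_def dn\<^sub>0 p\<^sub>0 S)
    moreover have "dt ?g = min (pt f) (m + 1)" "mt ?g = mt f" "ps ?g = ds f + S" "ds ?g = ps f"
      using atomic by (simp_all add: child_frame_def Let_def m dn\<^sub>0 p\<^sub>0 S)
    ultimately have within_g: "within_thresholds T E ?g \<longleftrightarrow>
        pn T E w + enat S < dt f \<and> dn T E w < pt f \<and> dn T E w \<le> m \<and>
        min (pn T E w + enat S + enat (ds f)) (dn T E w + enat (ps f)) < mt f"
      by (auto simp: within_thresholds_def less_enat_diff_iff less_min_plus_one_iff add.assoc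
          add.commute[of S] simp del: min_less_iff_conj)
    have "next_node T E ?v w \<longleftrightarrow> \<not> solved T E ?v \<and> dn T E w \<le> m"
      using int atomic child by (auto simp: next_node_def m_def le_INF_iff)
    then have "within_thresholds T E f \<and> next_node T E ?v w \<longleftrightarrow>
        within_thresholds T E f \<and> dn T E w \<le> m"
      using within_unsolved by blast
    \<comment> \<open>Given \<open>dn w \<le> m\<close>, \<open>pn v\<close> is \<open>dn w\<close>
      and \<open>dn v\<close> is \<open>pn w + S\<close>: the bounds match with proof and disproof
      roles exchanged.\<close>
    also have "\<dots> \<longleftrightarrow> within_thresholds T E ?g"
      unfolding within_g by (auto simp: within_thresholds_def pn dn min.commute min_absorb1)
    finally show ?thesis ..
  next
    case pending
    then obtain i where i: "i < num_parts T ?v - 1" "w = component_node T E\<^sub>0 ?v i"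
      "\<forall>i' < i. gn_known T E\<^sub>0 ?v i'"
      using sel(2) by (auto simp: next_node_def)
    define j where "j = (LEAST j. \<not> proved T E\<^sub>0 (?v @ [Component i j]))"
    have e: "e = Component i j"
      using i w by (simp add: component_node_def j_def)
    have proved_eq: "proved T E (?v @ [e']) \<longleftrightarrow> proved T E\<^sub>0 (?v @ [e'])" if "e' \<noteq> e" for e'
      using that by (simp add: proved_def pn_eq dn_eq)
    \<comment> \<open>Both the least unproved heap size and the node it selects involve only edges
      with index \<open>i'\<close>, all different from \<open>e\<close>.\<close>
    have x_eq: "component_node T E ?v i' = component_node T E\<^sub>0 ?v i'" if "i' \<noteq> i" for i'
      using that by (simp add: component_node_def proved_eq e)
    have mu_eq: "pn T E (component_node T E ?v i') = pn T E\<^sub>0 (component_node T E\<^sub>0 ?v i')"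
      "dn T E (component_node T E ?v i') = dn T E\<^sub>0 (component_node T E\<^sub>0 ?v i')" if "i' \<noteq> i" for i'
      using that unfolding x_eq[OF that] by (simp_all add: component_node_def pn_eq dn_eq e)
    have known_eq: "gn_known T E ?v i' \<longleftrightarrow> gn_known T E\<^sub>0 ?v i'" if "i' \<noteq> i" for i'
      using that by (simp add: gn_known_def disproved_def mu_eq)
    let ?x = "component_node T E\<^sub>0 ?v"
    let ?I = "{..<num_parts T ?v} - {i}"
    have "i \<in> {..<num_parts T ?v}"
      using i(1) by simp
    note sum_split = sum.remove[OF finite_lessThan this]
    obtain S where S: "(\<Sum>i'\<in>?I. min (pn T E\<^sub>0 (?x i')) (dn T E\<^sub>0 (?x i'))) = enat S"
      by (cases "\<Sum>i'\<in>?I. min (pn T E\<^sub>0 (?x i')) (dn T E\<^sub>0 (?x i'))")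
        (auto simp: sum_enat_eq_infinity_iff min_pn_dn_finite)
    obtain m where m: "min (pn T E\<^sub>0 w) (dn T E\<^sub>0 w) = enat m"
      using min_pn_dn_finite by (metis not_infinity_eq)
    have pn\<^sub>0: "pn T E\<^sub>0 ?v = enat (m + S)" "dn T E\<^sub>0 ?v = enat (m + S)"
      using pn_dn_decomposable[OF int\<^sub>0 pending] m S i(2) by (simp_all add: sum_split)
    define t where "t = min (pt f) (min (dt f) (mt f - enat (min (ps f) (ds f))))"
    \<comment> \<open>With one common value \<open>a\<close> for both numbers, the minimum in the
      third bound merely picks the smaller of \<open>ps\<close> and \<open>ds\<close>.\<close>
    have t_iff: "a < t \<longleftrightarrow> a < pt f \<and> a < dt f \<and> min (a + enat (ps f)) (a + enat (ds f)) < mt f" for a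
    proof -
      have "min (a + enat (ps f)) (a + enat (ds f)) = a + enat (min (ps f) (ds f))"
        by (cases a) auto
      then show ?thesis
        unfolding t_def by (simp add: less_enat_diff_iff)
    qed
    \<comment> \<open>Again this prevents truncation, so that \<open>t - (m + S) + m\<close> is
      \<open>t - S\<close>.\<close>
    have "enat (m + S) < t"
      using sel(1) unfolding t_iff by (simp add: within_thresholds_def pn\<^sub>0)
    then have "mt ?g = t - enat S"
      using pending by (cases t) (simp_all add: child_frame_def Let_def t_def[symmetric] pn\<^sub>0 m)
    moreover have "pt ?g = \<infinity>" "dt ?g = \<infinity>" "ps ?g = 0" "ds ?g = 0"
      using pending by (simp_all add: child_frame_def Let_def)
    \<comment> \<open>The infinite thresholds \<open>pt\<close> and \<open>dt\<close> say exactly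
      that \<open>w\<close> is unsolved.\<close>
    ultimately have within_g: "within_thresholds T E ?g \<longleftrightarrow>
        \<not> solved T E w \<and> min (pn T E w) (dn T E w) + enat S < t"
      by (auto simp: within_thresholds_def less_enat_diff_iff not_solved_iff zero_enat_def[symmetric])
    show ?thesis
    proof (cases "solved T E w")
      case True
      then show ?thesis
        using next_node_not_solved within_g by blast
    next
      case False
      \<comment> \<open>While \<open>w\<close> is unsolved, heap size \<open>j\<close> is not
        proved. The other sizes keep their status, so \<open>w\<close> remains the current node of
        component \<open>i\<close>.\<close>
      have "(LEAST j. \<not> proved T E (?v @ [Component i j])) = j"
      proof (rule Least_equality)
        show "\<not> proved T E (?v @ [Component i j])"
          using False by (simp add: w e solved_def)
        show "j \<le> j'" if "\<not> proved T E (?v @ [Component i j'])" for j'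
        proof (cases "j' = j")
          case False
          then have "\<not> proved T E\<^sub>0 (?v @ [Component i j'])"
            using that proved_eq[of "Component i j'"] e by simp
          then show ?thesis
            unfolding j_def by (rule Least_le)
        qed simp
      qed
      then have x: "component_node T E ?v i = w"
        by (simp add: component_node_def w e)
      then have unknown: "\<not> gn_known T E ?v i"
        using False not_gn_known_iff by metis
      then have not_final: "\<not> final_generated T E ?v"
        using i(1) by (auto simp: final_generated_def)
      have pn: "pn T E ?v = min (pn T E w) (dn T E w) + enat S" "dn T E ?v = pn T E ?v"
        using pn_dn_decomposable[OF int pending(1) not_final] S by (simp_all add: sum_split x mu_eq)
      have "next_node T E ?v w \<longleftrightarrow> \<not> solved T E ?v"
        using int pending(1) not_final i unknown x known_eq by (auto simp: next_node_def)
      then have "within_thresholds T E f \<and> next_node T E ?v w \<longleftrightarrow> within_thresholds T E f"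
        using within_unsolved by blast
      also have "\<dots> \<longleftrightarrow> pn T E ?v < t"
        by (simp add: within_thresholds_def t_iff pn(2))
      also have "\<dots> \<longleftrightarrow> within_thresholds T E ?g"
        using False by (simp add: within_g pn(1))
      finally show ?thesis ..
    qed
  next
    case final
    then have e: "e = Final"
      using sel(2) w by (simp add: next_node_def)
    \<comment> \<open>This depends on component edges only, whereas the search takes place below
      \<open>Final\<close>.\<close>
    have "final_generated T E ?v"
      using final(2) by (simp add: final_generated_def gn_known_def component_node_def proved_def
          disproved_def pn_eq dn_eq e)
    note eqs = pn_dn_decomposable_final[OF int final(1) this]
    have "next_node T E ?v w \<longleftrightarrow> \<not> solved T E ?v"
      using int final(1) \<open>final_generated T E ?v\<close> by (simp add: next_node_def w e)
    moreover have "within_thresholds T E ?g \<longleftrightarrow> within_thresholds T E f"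
      using final by (simp add: within_thresholds_def child_frame_def w e eqs)
    ultimately show ?thesis
      using within_unsolved by blast
  qed
qed

end

section \<open>The invariant of the explored path\<close>

text \<open>Each frame carries its own selection tree \<open>E\<^sub>0\<close>, while
  \<open>E\<close> is the current tree for the whole path. The conditions on
  \<open>E\<^sub>0\<close> are those needed to compare the thresholds of parent and child in
  \<open>E\<close>.\<close>

inductive explored :: "'p nand_tree \<Rightarrow> 'p node fset \<Rightarrow> 'p frame list \<Rightarrow> bool" for T E where
  root: "explored T E [\<lparr>node = [], pt = \<infinity>, dt = \<infinity>, mt = \<infinity>, ps = 0, ds = 0\<rparr>]"
| child: "explored T E (fs @ [f]) \<Longrightarrow> within_thresholds T E\<^sub>0 f \<Longrightarrow> next_node T E\<^sub>0 (node f) w \<Longrightarrow>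
    E\<^sub>0 |\<subseteq>| E \<Longrightarrow> (\<And>u. u |\<in>| E \<Longrightarrow> u |\<notin>| E\<^sub>0 \<Longrightarrow> prefix w u) \<Longrightarrow>
    explored T E (fs @ [f, child_frame T E\<^sub>0 f w])"

lemma explored_butlast:
  assumes "explored T E (fs @ [f])"
  shows "fs = [] \<or> explored T E fs"
  using assms
proof (cases rule: explored.cases)
  case (child fs' f' E\<^sub>0 w)
  from child(1) have "fs = fs' @ [f']"
    by (metis append.assoc append_Cons append_Nil butlast_snoc)
  with child show ?thesis by simp
qed simp

text \<open>The nodes on the path form a chain of prefixes, so an expansion below the last one lies
  below all of them.\<close>

lemma explored_finsert:
  assumes "explored T E fs" "prefix (node (last fs)) u"
  shows "explored T (finsert u E) fs"
  using assms
proof induction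
  case root
  show ?case by (rule explored.root)
next
  case (child fs f E\<^sub>0 w)
  have "prefix w u"
    using child.prems by simp
  moreover from this obtain e where "w = node f @ [e]"
    using child.hyps next_node_extends by blast
  ultimately have "prefix (node f) u"
    by (auto dest: append_prefixD)
  then have "explored T (finsert u E) (fs @ [f])"
    using child.IH by simp
  then show ?case
    using child.hyps \<open>prefix w u\<close> by (intro explored.child) auto
qed

text \<open>A selection takes \<open>E\<^sub>0\<close> to be the current tree, which makes its side
  conditions trivial. Later expansions happen at the end of the path.\<close>

lemma explored_reachable:
  assumes "dfpn_reachable T (E, fs)"
  shows "fs = [] \<or> explored T E fs"
proof -
  have "(dfpn_step T)\<^sup>*\<^sup>* initial_state s \<Longrightarrow> snd s = [] \<or> explored T (fst s) (snd s)" for s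
  proof (induction rule: rtranclp_induct)
    case base
    show ?case
      by (simp add: initial_state_def explored.root)
  next
    case (step s s')
    from step.hyps(2) step.IH show ?case
    proof cases
      case (expand E f fs)
      then show ?thesis
        using step.IH explored_finsert[of T E "fs @ [f]" "node f"] by simp
    next
      case (select E f w fs)
      then show ?thesis
        using step.IH explored.child[of T E fs f E w] by simp
    next
      case (backtrack E f fs)
      then show ?thesis
        using step.IH explored_butlast[of T E fs f] by simp
    qed
  qed
  then show ?thesis
    using assms by (fastforce simp: dfpn_reachable_def)
qed

context extended_nand_tree
begin

text \<open>At the root the infinite thresholds say that it is unsolved. Each further frame adds to
  both sides the condition that its node is a next node of its parent.\<close>

lemma explored_mpn_iff:
  "explored T E fs \<Longrightarrow> f \<in> set fs \<Longrightarrow> mpn_in_subtree T E (node f) \<longleftrightarrow> within_thresholds T E f"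
proof (induction arbitrary: f rule: explored.induct)
  case root
  then show ?case
    by (auto simp: mpn_in_subtree_iff not_solved_iff within_thresholds_def min_less_iff_disj)
next
  case (child fs f' E\<^sub>0 w)
  show ?case
  proof (cases "f = child_frame T E\<^sub>0 f' w")
    case True
    obtain e where "w = node f' @ [e]"
      using child.hyps next_node_extends by blast
    then have "mpn_in_subtree T E w \<longleftrightarrow> mpn_in_subtree T E (node f') \<and> next_node T E (node f') w"
      by (simp add: mpn_in_subtree_append)
    also have "\<dots> \<longleftrightarrow> within_thresholds T E f' \<and> next_node T E (node f') w"
      using child.IH by simp
    also have "\<dots> \<longleftrightarrow> within_thresholds T E f"
      using within_thresholds_child_frame[OF child.hyps(2-5)] True by simp
    finally show ?thesis
      using True by simp
  next
    case False
    then show ?thesis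
      using child.IH child.prems by auto
  qed
qed

end

theorem theorem2:
  fixes T :: "'p nand_tree" and E :: "'p node fset" and path :: "'p frame list" and f :: "'p frame"
  assumes "extended_nand_tree T"
    and "dfpn_reachable T (E, path)"
    and "f \<in> set path"
  shows "mpn_in_subtree T E (node f) \<longleftrightarrow>
    pn T E (node f) < pt f \<and> dn T E (node f) < dt f \<and>
    min (pn T E (node f) + enat (ps f)) (dn T E (node f) + enat (ds f)) < mt f"
proof -
  have "explored T E path"
    using explored_reachable assms(2,3) by fastforce
  then show ?thesis
    using extended_nand_tree.explored_mpn_iff[OF assms(1)] assms(3)
    unfolding within_thresholds_def by blast
qed

end
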